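(* Let the function $T^F_\Omega$ be convex. Then the following assertions hold. (i) For any $\bar x\in\Omega$, $$\partial T^F_\Omega(\bar x)=N(\bar x;\Omega)\cap C^*.$$ (ii) For any $\bar x\notin\Omega$ with $T^F_\Omega(\bar x)<\infty$, $$\partial T^F_\Omega(\bar x)=N(\bar x;\Omega_r)\cap S^*,\qquad\text{where } r=T^F_\Omega(\bar x)>0.$$
   Context: $X$ is an arbitrary (real) Banach space with topological dual $X^*$ and pairing $\langle\cdot,\cdot\rangle$. Standing assumptions: $\Omega\subset X$ is nonempty and closed; $F\subset X$ is nonempty, closed, bounded and convex (it is not assumed that $0\in\mathrm{int}\,F$). The minimal time function is $T^F_\Omega(x):=\inf\{t\ge 0\mid \Omega\cap(x+tF)\ne\emptyset\}\in[0,\infty]$, with $\inf\emptyset=\infty$; for $r>0$ the enlargement of $\Omega$ is $\Omega_r:=\{x\in X\mid T^F_\Omega(x)\le r\}$. (Convexity of $T^F_\Omega$ is equivalent to convexity of $\Omega$.) The support function of $F$ is $\sigma_F(x^* ):=\sup_{x\in F}\langle x^*,x\rangle$. Put $C^*:=\{x^*\in X^*\mid\sigma_F(-x^* )\le1\}$ and $S^*:=\{x^*\in X^*\mid\sigma_F(-x^* )=1\}$. In this convex setting the basic subdifferential and basic normal cone are those of convex analysis: for a convex $\varphi:X\to(-\infty,\infty]$ with $\varphi(\bar x)<\infty$, $\partial\varphi(\bar x)=\{x^*\in X^*\mid\langle x^*,x-\bar x\rangle\le\varphi(x)-\varphi(\bar x)\text{ for all }x\in X\}$; for a convex set $\Theta$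 and $\bar x\in\Theta$, $N(\bar x;\Theta)=\{x^*\in X^*\mid\langle x^*,x-\bar x\rangle\le0\text{ for all }x\in\Theta\}$. *)

theory Defs
  imports "HOL-Analysis.Analysis"
begin

text \<open>The dual \<open>X*\<close> is the type \<open>'a \<Rightarrow>\<^sub>L real\<close>; extended-real values live in \<open>ereal\<close>,
  where \<open>Inf {} = \<infinity>\<close>.\<close>

definition min_time :: "'a::real_normed_vector set \<Rightarrow> 'a set \<Rightarrow> 'a \<Rightarrow> ereal" where
  "min_time F \<Omega> x = Inf {ereal t | t. 0 \<le> t \<and> \<Omega> \<inter> ((\<lambda>f. x + t *\<^sub>R f) ` F) \<noteq> {}}"

definition enlargement :: "'a::real_normed_vector set \<Rightarrow> 'a set \<Rightarrow> real \<Rightarrow> 'a set" where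
  "enlargement F \<Omega> r = {x. min_time F \<Omega> x \<le> ereal r}"

definition support_fun :: "'a::real_normed_vector set \<Rightarrow> ('a \<Rightarrow>\<^sub>L real) \<Rightarrow> ereal" where
  "support_fun F x' = (SUP x\<in>F. ereal (blinfun_apply x' x))"

definition C_star :: "'a::real_normed_vector set \<Rightarrow> ('a \<Rightarrow>\<^sub>L real) set" where
  "C_star F = {x'. support_fun F (- x') \<le> 1}"

definition S_star :: "'a::real_normed_vector set \<Rightarrow> ('a \<Rightarrow>\<^sub>L real) set" where
  "S_star F = {x'. support_fun F (- x') = 1}"

text \<open>The library's \<open>convex_on\<close> does not apply to \<open>ereal\<close>-valued functions, as \<open>ereal\<close> is
  not a vector space. The inequality below is intended for functions that never take the
  value \<open>-\<infinity>\<close>, so the right-hand side is never of the form \<open>\<infinity> - \<infinity>\<close>.\<close>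

definition convex_ereal_fun :: "('a::real_vector \<Rightarrow> ereal) \<Rightarrow> bool" where
  "convex_ereal_fun \<phi> \<longleftrightarrow>
     (\<forall>x y. \<forall>u\<in>{0<..<1::real}.
        \<phi> (u *\<^sub>R x + (1 - u) *\<^sub>R y) \<le> ereal u * \<phi> x + ereal (1 - u) * \<phi> y)"

text \<open>Subdifferential and normal cone of convex analysis, with the usual convention that they
  are empty at points outside the domain of the function, respectively outside the set.\<close>

definition subdifferential ::
    "('a::real_normed_vector \<Rightarrow> ereal) \<Rightarrow> 'a \<Rightarrow> ('a \<Rightarrow>\<^sub>L real) set" where
  "subdifferential \<phi> a =
     {x'. \<phi> a < \<infinity> \<and> (\<forall>x. ereal (blinfun_apply x' (x - a)) \<le> \<phi> x - \<phi> a)}"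

definition normal_cone :: "'a::real_normed_vector \<Rightarrow> 'a set \<Rightarrow> ('a \<Rightarrow>\<^sub>L real) set" where
  "normal_cone a \<Theta> = {x'. a \<in> \<Theta> \<and> (\<forall>x\<in>\<Theta>. blinfun_apply x' (x - a) \<le> 0)}"

end

theory Submission
  imports Defs
begin

text \<open>
  Write \<open>T\<close> for the minimal time function and \<open>r = T a\<close> for its value at the base point \<open>a\<close>.
  Everything rests on the behaviour of \<open>T\<close> along directions \<open>f\<close> of \<open>F\<close>. Starting further back, at
  \<open>x - s f\<close>, costs at most \<open>s\<close> more time (\<open>min_time_diff_scale_le\<close>, where convexity of \<open>F\<close> enters);
  conversely, travelling from \<open>x\<close> towards a target point \<open>x + s f\<close> reaches the enlargement
  \<open>\<Omega>\<^sub>r\<close> by the time \<open>s - r\<close>.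

  If \<open>x'\<close> is a subgradient at \<open>a\<close>, then it is normal to \<open>\<Omega>\<^sub>r\<close>, because this set is the sublevel set
  of \<open>T\<close> at height \<open>T a\<close>, and testing it at \<open>a - f\<close> gives \<open>\<sigma>\<^sub>F (-x') \<le> 1\<close>. If \<open>r > 0\<close>, testing it
  at points of \<open>\<Omega>\<close> that are reached from \<open>a\<close> in a time close to \<open>r\<close> gives
  \<open>\<sigma>\<^sub>F (-x') \<ge> 1\<close>.

  If \<open>x'\<close> is normal to \<open>\<Omega>\<^sub>r\<close> at \<open>a\<close>, the subgradient inequality at \<open>x\<close> follows by moving
  \<open>x\<close> into \<open>\<Omega>\<^sub>r\<close> along \<open>F\<close> and applying normality there. If \<open>T x \<ge> r\<close>, the move is forwards and
  \<open>\<sigma>\<^sub>F (-x') \<le> 1\<close> bounds its contribution. If \<open>T x < r\<close>, there is room to move backwards for the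
  time \<open>r - T x\<close>, and \<open>\<sigma>\<^sub>F (-x') \<ge> 1\<close> provides directions along which this gains enough.

  The case \<open>a \<in> \<Omega>\<close> is the same argument with \<open>r = 0\<close>: closedness of \<open>\<Omega>\<close> and boundedness of \<open>F\<close>
  give \<open>\<Omega>\<^sub>0 = \<Omega>\<close>, and since \<open>T x < 0\<close> never happens, \<open>\<sigma>\<^sub>F (-x') \<le> 1\<close> suffices.
\<close>

lemma min_time_le:
  assumes "0 \<le> t" "f \<in> F" "x + t *\<^sub>R f \<in> \<Omega>"
  shows "min_time F \<Omega> x \<le> ereal t"
  unfolding min_time_def using assms by (intro Inf_lower) blast

lemma min_time_nonneg: "0 \<le> min_time F \<Omega> x"
  unfolding min_time_def by (intro Inf_greatest) auto

lemma min_time_lessE: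
  assumes "min_time F \<Omega> x < ereal s"
  obtains t f where "0 \<le> t" "t < s" "f \<in> F" "x + t *\<^sub>R f \<in> \<Omega>"
  using assms unfolding min_time_def Inf_less_iff by auto

lemma min_time_realE:
  assumes "min_time F \<Omega> x < \<infinity>"
  obtains r where "min_time F \<Omega> x = ereal r" "0 \<le> r"
  using assms min_time_nonneg[of F \<Omega> x] by (cases "min_time F \<Omega> x") auto

text \<open>Going from \<open>x - s f\<close> via \<open>x\<close> to a target point \<open>x + t g\<close> uses the displacement
  \<open>s f + t g\<close>, which convexity replaces by \<open>s + t\<close> times one direction of \<open>F\<close>.\<close>

lemma min_time_diff_scale_le:
  assumes F: "convex F" "f \<in> F" and s: "0 \<le> s"
  shows "min_time F \<Omega> (x - s *\<^sub>R f) \<le> ereal s + min_time F \<Omega> x"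
proof (cases "min_time F \<Omega> x < \<infinity>")
  case True
  then obtain r where r: "min_time F \<Omega> x = ereal r" "0 \<le> r"
    by (rule min_time_realE)
  have "min_time F \<Omega> (x - s *\<^sub>R f) \<le> ereal (s + r) + ereal e" if e: "0 < e" for e
  proof -
    from r e have "min_time F \<Omega> x < ereal (r + e)" by simp
    then obtain t g where tg: "0 \<le> t" "t < r + e" "g \<in> F" "x + t *\<^sub>R g \<in> \<Omega>"
      by (rule min_time_lessE)
    obtain h where h: "h \<in> F" "s *\<^sub>R f + t *\<^sub>R g = (s + t) *\<^sub>R h"
    proof (cases "s + t = 0")
      case True
      with s tg have "s = 0" "t = 0" by auto
      with F that show ?thesis by simp
    next
      case False
      have "(s / (s + t)) *\<^sub>R f + (t / (s + t)) *\<^sub>R g \<in> F"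
        using F s tg False by (intro convexD) (auto simp: add_divide_distrib[symmetric])
      moreover have "s *\<^sub>R f + t *\<^sub>R g = (s + t) *\<^sub>R ((s / (s + t)) *\<^sub>R f + (t / (s + t)) *\<^sub>R g)"
        using False by (simp add: scaleR_add_right)
      ultimately show ?thesis using that by blast
    qed
    have eq: "x - s *\<^sub>R f + (s + t) *\<^sub>R h = x + t *\<^sub>R g"
      by (simp flip: h(2))
    have "x - s *\<^sub>R f + (s + t) *\<^sub>R h \<in> \<Omega>"
      unfolding eq by (rule tg(4))
    then have "min_time F \<Omega> (x - s *\<^sub>R f) \<le> ereal (s + t)"
      using s tg(1) h(1) by (intro min_time_le[where f = h]) simp_all
    also have "\<dots> \<le> ereal (s + r) + ereal e" using tg by simp
    finally show ?thesis .
  qed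
  then have "min_time F \<Omega> (x - s *\<^sub>R f) \<le> ereal (s + r)"
    by (rule ereal_le_epsilon2)
  then show ?thesis using r by simp
qed auto

text \<open>Points with zero minimal time are limits of target points \<open>x + t f\<close> with \<open>t\<close> tending to
  \<open>0\<close>, as boundedness of \<open>F\<close> controls the displacement.\<close>

lemma enlargement_zero:
  assumes "closed \<Omega>" "F \<noteq> {}" "bounded F"
  shows "enlargement F \<Omega> 0 = \<Omega>"
proof
  show "\<Omega> \<subseteq> enlargement F \<Omega> 0"
    using assms(2) min_time_le[of 0 _ F _ \<Omega>] by (fastforce simp: enlargement_def)
  show "enlargement F \<Omega> 0 \<subseteq> \<Omega>"
  proof
    fix x assume "x \<in> enlargement F \<Omega> 0"
    then have x: "min_time F \<Omega> x \<le> 0" by (simp add: enlargement_def zero_ereal_def)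
    from \<open>bounded F\<close> obtain B where B: "0 < B" "\<And>f. f \<in> F \<Longrightarrow> norm f \<le> B"
      by (auto simp: bounded_pos)
    have "\<exists>y\<in>\<Omega>. dist y x < e" if e: "0 < e" for e
    proof -
      from e B have "min_time F \<Omega> x < ereal (e / B)"
        using x by (intro le_less_trans[OF x]) simp
      then obtain t f where tf: "0 \<le> t" "t < e / B" "f \<in> F" "x + t *\<^sub>R f \<in> \<Omega>"
        by (rule min_time_lessE)
      have "dist (x + t *\<^sub>R f) x = t * norm f" using tf by (simp add: dist_norm)
      also have "\<dots> \<le> t * B" using tf B by (intro mult_left_mono) auto
      also have "\<dots> < e" using tf B by (simp add: field_simps)
      finally show ?thesis using tf by blast
    qed
    then have "x \<in> closure \<Omega>" by (simp add: closure_approachable)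
    then show "x \<in> \<Omega>" using \<open>closed \<Omega>\<close> by simp
  qed
qed

lemma support_fun_uminus_le_1_iff:
  "support_fun F (- x') \<le> 1 \<longleftrightarrow> (\<forall>f\<in>F. - blinfun_apply x' f \<le> 1)"
  by (simp add: support_fun_def SUP_le_iff uminus_blinfun.rep_eq one_ereal_def)

lemma subdifferential_iff:
  assumes "\<phi> a = ereal r"
  shows "x' \<in> subdifferential \<phi> a \<longleftrightarrow> (\<forall>x. ereal (blinfun_apply x' (x - a) + r) \<le> \<phi> x)"
proof -
  have "ereal (blinfun_apply x' (x - a)) \<le> \<phi> x - \<phi> a \<longleftrightarrow>
        ereal (blinfun_apply x' (x - a) + r) \<le> \<phi> x" for x
    using assms by (cases "\<phi> x") (auto simp: algebra_simps)
  with assms show ?thesis by (simp add: subdifferential_def)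
qed

lemma subgradient_normal_to_enlargement:
  assumes r: "min_time F \<Omega> a = ereal r" and x': "x' \<in> subdifferential (min_time F \<Omega>) a"
  shows "x' \<in> normal_cone a (enlargement F \<Omega> r)"
  unfolding normal_cone_def enlargement_def
proof (clarsimp simp: r)
  fix x assume "min_time F \<Omega> x \<le> ereal r"
  then have "ereal (blinfun_apply x' (x - a) + r) \<le> ereal r"
    using x' unfolding subdifferential_iff[of "min_time F \<Omega>", OF r] by (blast intro: order_trans)
  then show "blinfun_apply x' (x - a) \<le> 0" by simp
qed

text \<open>The subgradient inequality at \<open>a - f\<close>, whose minimal time exceeds that of \<open>a\<close> by at most
  \<open>1\<close>.\<close>

lemma subgradient_in_C_star:
  assumes "convex F"
    and r: "min_time F \<Omega> a = ereal r" and x': "x' \<in> subdifferential (min_time F \<Omega>) a"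
  shows "x' \<in> C_star F"
  unfolding C_star_def mem_Collect_eq support_fun_uminus_le_1_iff
proof
  fix f assume f: "f \<in> F"
  have "ereal (blinfun_apply x' ((a - f) - a) + r) \<le> min_time F \<Omega> (a - f)"
    using x' unfolding subdifferential_iff[of "min_time F \<Omega>", OF r] by blast
  also have "\<dots> \<le> ereal (1 + r)"
    using min_time_diff_scale_le[OF \<open>convex F\<close> f, of 1 \<Omega> a] r by simp
  finally show "- blinfun_apply x' f \<le> 1" by (simp add: blinfun.minus_right)
qed

text \<open>Along a nearly optimal direction \<open>f\<close>, which reaches \<open>\<Omega>\<close> from \<open>a\<close> in a time \<open>t\<close> close
  to \<open>r\<close>, the minimal time drops from \<open>r\<close> to \<open>0\<close>. The subgradient inequality then gives
  \<open>- x' f \<ge> r / t\<close>.\<close>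

lemma subgradient_support_fun_ge_1:
  assumes r: "min_time F \<Omega> a = ereal r" "0 < r"
    and x': "x' \<in> subdifferential (min_time F \<Omega>) a"
  shows "1 \<le> support_fun F (- x')"
proof -
  have "c \<le> support_fun F (- x')" if c: "0 < c" "c < 1" for c :: real
  proof -
    have "min_time F \<Omega> a < ereal (r / c)" using r c by (simp add: field_simps)
    then obtain t f where tf: "0 \<le> t" "t < r / c" "f \<in> F" "a + t *\<^sub>R f \<in> \<Omega>"
      by (rule min_time_lessE)
    have "ereal (blinfun_apply x' ((a + t *\<^sub>R f) - a) + r) \<le> min_time F \<Omega> (a + t *\<^sub>R f)"
      using x' unfolding subdifferential_iff[of "min_time F \<Omega>", OF r(1)] by blast
    also have "\<dots> \<le> ereal 0" using tf by (intro min_time_le[where f = f]) auto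
    finally have *: "r \<le> t * (- blinfun_apply x' f)" by (simp add: blinfun.scaleR_right)
    have "t * c \<le> r" using tf c by (simp add: field_simps)
    with * have "t * c \<le> t * (- blinfun_apply x' f)" by linarith
    moreover have "t \<noteq> 0" using * r by auto
    ultimately have "c \<le> - blinfun_apply x' f"
      using tf(1) by (auto simp only: mult_le_cancel_left)
    also have "ereal (- blinfun_apply x' f) \<le> support_fun F (- x')"
      unfolding support_fun_def using tf(3)
      by (intro SUP_upper2[of f]) (auto simp: uminus_blinfun.rep_eq)
    finally show ?thesis by simp
  qed
  note ge = this
  show ?thesis
  proof (rule ccontr)
    assume "\<not> 1 \<le> support_fun F (- x')"
    then obtain q where q: "support_fun F (- x') < ereal q" "ereal q < 1"
      using ereal_dense2[of "support_fun F (- x')" 1] by (auto simp: not_le)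
    \<comment> \<open>The maximum with \<open>1/2\<close> keeps the constant positive when \<open>q\<close> is not.\<close>
    have "ereal (max q (1/2)) \<le> support_fun F (- x')"
      using q by (intro ge) (auto simp: one_ereal_def)
    also note q(1)
    finally show False by simp
  qed
qed

text \<open>Stopping a trip of duration
  \<open>s\<close> from \<open>x\<close> to \<open>\<Omega>\<close> at the time \<open>s - r\<close> leaves a point of \<open>\<Omega>\<^sub>r\<close>, where
  normality applies.\<close>

lemma normal_inequality_outside:
  assumes r: "0 \<le> r" "ereal r \<le> min_time F \<Omega> x"
    and N: "x' \<in> normal_cone a (enlargement F \<Omega> r)" and C: "x' \<in> C_star F"
  shows "ereal (blinfun_apply x' (x - a) + r) \<le> min_time F \<Omega> x"
proof (rule ccontr)
  assume "\<not> ?thesis"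
  then obtain s f where s: "0 \<le> s" "s < blinfun_apply x' (x - a) + r"
      and f: "f \<in> F" "x + s *\<^sub>R f \<in> \<Omega>"
    by (auto simp: not_le elim: min_time_lessE)
  then have "ereal r \<le> ereal s" using r by (blast intro: order_trans min_time_le)
  then have rs: "r \<le> s" by simp
  have "min_time F \<Omega> (x + (s - r) *\<^sub>R f) \<le> ereal r"
    using r f by (intro min_time_le[where f = f]) (auto simp: algebra_simps)
  then have "blinfun_apply x' (x + (s - r) *\<^sub>R f - a) \<le> 0"
    using N by (auto simp: normal_cone_def enlargement_def)
  moreover have "blinfun_apply x' (x + (s - r) *\<^sub>R f - a)
      = blinfun_apply x' (x - a) + (s - r) * blinfun_apply x' f"
    by (simp add: blinfun.add_right blinfun.diff_right blinfun.scaleR_right)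
  moreover have "(s - r) * (- blinfun_apply x' f) \<le> (s - r) * 1"
    using C f rs unfolding C_star_def mem_Collect_eq support_fun_uminus_le_1_iff
    by (intro mult_left_mono) auto
  ultimately show False using s by simp
qed

text \<open>Inside the sublevel set, every point \<open>x - (r - t) f\<close> with \<open>t = T x\<close> still lies in
  \<open>\<Omega>\<^sub>r\<close>; a direction \<open>f\<close> with \<open>- x' f\<close> close to \<open>1\<close> makes normality there as strong as
  required.\<close>

lemma normal_inequality_inside:
  assumes "convex F" and x: "min_time F \<Omega> x < ereal r"
    and N: "x' \<in> normal_cone a (enlargement F \<Omega> r)" and S: "1 \<le> support_fun F (- x')"
  shows "ereal (blinfun_apply x' (x - a) + r) \<le> min_time F \<Omega> x"
proof -
  have "min_time F \<Omega> x < \<infinity>" using x by (auto intro: less_trans)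
  then obtain t where t: "min_time F \<Omega> x = ereal t" "0 \<le> t" by (rule min_time_realE)
  with x have tr: "t < r" by simp
  have *: "(r - t) * (- blinfun_apply x' f) \<le> - blinfun_apply x' (x - a)" if f: "f \<in> F" for f
  proof -
    have "min_time F \<Omega> (x - (r - t) *\<^sub>R f) \<le> ereal r"
      using min_time_diff_scale_le[OF \<open>convex F\<close> f, of "r - t" \<Omega> x] t tr by simp
    then have "blinfun_apply x' (x - (r - t) *\<^sub>R f - a) \<le> 0"
      using N by (auto simp: normal_cone_def enlargement_def)
    then show ?thesis
      by (simp add: blinfun.diff_right blinfun.scaleR_right)
  qed
  have "support_fun F (- x') \<le> ereal (- blinfun_apply x' (x - a) / (r - t))"
    unfolding support_fun_def using * tr
    by (intro SUP_least) (auto simp: uminus_blinfun.rep_eq field_simps)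
  with S have "ereal 1 \<le> ereal (- blinfun_apply x' (x - a) / (r - t))"
    unfolding one_ereal_def by (rule order_trans)
  then show ?thesis using tr t by (simp add: field_simps)
qed

theorem theorem7p1:
  fixes \<Omega> F :: "'a::banach set"
  assumes "\<Omega> \<noteq> {}" and "closed \<Omega>"
    and "F \<noteq> {}" and "closed F" and "bounded F" and "convex F"
    and "convex_ereal_fun (min_time F \<Omega>)"
  shows "(\<forall>x\<in>\<Omega>. subdifferential (min_time F \<Omega>) x = normal_cone x \<Omega> \<inter> C_star F) \<and>
    (\<forall>x. x \<notin> \<Omega> \<and> min_time F \<Omega> x < \<infinity> \<longrightarrow>
      (\<exists>r::real. min_time F \<Omega> x = ereal r \<and> r > 0 \<and>
        subdifferential (min_time F \<Omega>) x = normal_cone x (enlargement F \<Omega> r) \<inter> S_star F))"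
proof (intro conjI ballI allI impI)
  have \<Omega>0: "enlargement F \<Omega> 0 = \<Omega>" using assms by (intro enlargement_zero)
  {
    fix a assume "a \<in> \<Omega>"
    then have "min_time F \<Omega> a \<le> ereal 0" using \<Omega>0 by (auto simp: enlargement_def)
    then have a: "min_time F \<Omega> a = ereal 0"
      using min_time_nonneg[of F \<Omega> a] by (simp add: zero_ereal_def antisym)
    have "x' \<in> subdifferential (min_time F \<Omega>) a"
      if "x' \<in> normal_cone a \<Omega>" "x' \<in> C_star F" for x'
    proof -
      have "ereal (blinfun_apply x' (x - a) + 0) \<le> min_time F \<Omega> x" for x
      proof (rule normal_inequality_outside)
        show "ereal 0 \<le> min_time F \<Omega> x"
          using min_time_nonneg[of F \<Omega> x] unfolding zero_ereal_def .
      qed (use that in \<open>simp_all add: \<Omega>0\<close>)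
      then show ?thesis
        unfolding subdifferential_iff[of "min_time F \<Omega>", OF a] by blast
    qed
    then show "subdifferential (min_time F \<Omega>) a = normal_cone a \<Omega> \<inter> C_star F"
      using subgradient_normal_to_enlargement[OF a] subgradient_in_C_star[OF \<open>convex F\<close> a] \<Omega>0
      by auto
  next
    fix a assume "a \<notin> \<Omega> \<and> min_time F \<Omega> a < \<infinity>"
    then have "a \<notin> enlargement F \<Omega> 0" "min_time F \<Omega> a < \<infinity>" using \<Omega>0 by auto
    then obtain r where r: "min_time F \<Omega> a = ereal r" "0 \<le> r"
      by (blast elim: min_time_realE)
    with \<open>a \<notin> enlargement F \<Omega> 0\<close> have r0: "0 < r" by (auto simp: enlargement_def)
    have "x' \<in> subdifferential (min_time F \<Omega>) a"
      if N: "x' \<in> normal_cone a (enlargement F \<Omega> r)" and S: "x' \<in> S_star F" for x'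
      unfolding subdifferential_iff[of "min_time F \<Omega>", OF r(1)]
    proof
      fix x
      from S have "x' \<in> C_star F" "1 \<le> support_fun F (- x')"
        by (auto simp: S_star_def C_star_def)
      then show "ereal (blinfun_apply x' (x - a) + r) \<le> min_time F \<Omega> x"
        using normal_inequality_outside[OF r(2) _ N] normal_inequality_inside[OF \<open>convex F\<close> _ N]
        by (cases "ereal r \<le> min_time F \<Omega> x") auto
    qed
    moreover have "x' \<in> S_star F" if "x' \<in> subdifferential (min_time F \<Omega>) a" for x'
      using subgradient_in_C_star[OF \<open>convex F\<close> r(1) that]
        subgradient_support_fun_ge_1[OF r(1) r0 that]
      by (simp add: S_star_def C_star_def)
    ultimately have "subdifferential (min_time F \<Omega>) a =
        normal_cone a (enlargement F \<Omega> r) \<inter> S_star F"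
      using subgradient_normal_to_enlargement[OF r(1)] by blast
    with r r0 show "\<exists>r. min_time F \<Omega> a = ereal r \<and> r > 0 \<and>
        subdifferential (min_time F \<Omega>) a = normal_cone a (enlargement F \<Omega> r) \<inter> S_star F"
      by blast
  }
qed

end
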